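(* Let $\mathcal{K}(\mathbb{E}_2)\cong\mathbb{R}^6$ be the space of Killing $2$-tensors of the Euclidean plane with coordinates $(A,B,C,\alpha,\beta,\gamma)$, let $\Delta_E$ be the distribution spanned by $V_1,\dots,V_6$, let $G_E$ be the web-type preserving group, and let $S_1,S_2,S_3$ be the subsets defined in the context. The rank of the distribution $\Delta_E$ on $(S_1\cap S_2)\setminus S_3$ is $3$, and $(S_1\cap S_2)\setminus S_3$ is an orbit of the action of $G_E$ on $\mathcal{K}(\mathbb{E}_2)$.
   Context: In the Euclidean plane $\mathbb{E}_2$ with Cartesian coordinates $(x,y)$ and standard metric $\mathbf{g}$, the general Killing $2$-tensor has contravariant components $K^{11}=A+2\alpha y+\gamma y^2$, $K^{12}=K^{21}=C-\alpha x-\beta y-\gamma xy$, $K^{22}=B+2\beta x+\gamma x^2$, with $A,B,C,\alpha,\beta,\gamma\in\mathbb{R}$. So the vector space $\mathcal{K}(\mathbb{E}_2)$ of Killing $2$-tensors is identified with $\mathbb{R}^6$ with coordinates $(A,B,C,\alpha,\beta,\gamma)$. With respect to $(\partial_A,\partial_B,\partial_C,\partial_\alpha,\partial_\beta,\partial_\gamma)$ define the following vector fields on $\mathcal{K}(\mathbb{E}_2)$, generating the transformations which preserve the type of the web: $V_1=(0,-2\beta,\alpha,0,-\gamma,0)$ and $V_2=(-2\alpha,0,\beta,-\gamma,0,0)$ (translations); $V_3=(-2C,2C,A-B,\beta,-\alpha,0)$ (rotation); $V_4=(2A,2B,2C,\alpha,\beta,0)$ (dilatation of the plane); $V_5=(1,1,0,0,0,0)$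 (addition of a multiple of the metric, $\mathbf{K}\mapsto\mathbf{K}+\tau\mathbf{g}$); $V_6=(A,B,C,\alpha,\beta,\gamma)$ (scalar multiplication, $\mathbf{K}\mapsto\lambda\mathbf{K}$). $\Delta_E$ is the distribution spanned by $V_1,\dots,V_6$; its rank at a point is the dimension of the span of the values of $V_1,\dots,V_6$ at that point. $G_E$ is the group of transformations of $\mathcal{K}(\mathbb{E}_2)$ generated by the flows of $V_1,\dots,V_6$ together with the change of sign $\mathbf{K}\mapsto-\mathbf{K}$. $S_1=\{\gamma=0\}$; $S_2=\{\alpha^2-\beta^2=\gamma(A-B),\ \alpha\beta=-\gamma C\}$; $S_3=\{\alpha=\beta=\gamma=0,\ C=0,\ A=B\}$. *)

theory Defs
  imports "HOL-Analysis.Analysis" "HOL-Algebra.Group_Action" "HOL-Algebra.Generated_Groups"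
begin

text \<open>
  Killing 2-tensors of the Euclidean plane are represented by their six coordinates
  (A, B, C, \<alpha>, \<beta>, \<gamma>). The nested product of reals is used rather than \<open>real ^ 6\<close>, so that the
  coordinates can be bound by pattern matching.
\<close>

type_synonym killing = "real \<times> real \<times> real \<times> real \<times> real \<times> real"

text \<open>
  The tensor field with given coordinates, as the matrix of its contravariant components at the
  point z = (x, y). The two lemmas below show that the coordinates identify the vector space of
  these tensor fields with \<^typ>\<open>killing\<close>.
\<close>

fun killing_tensor :: "killing \<Rightarrow> real^2 \<Rightarrow> real^2^2" where
  "killing_tensor (A, B, C, \<alpha>, \<beta>, \<gamma>) z =
    (let x = z $ 1; y = z $ 2;
         K12 = C - \<alpha> * x - \<beta> * y - \<gamma> * x * y
     in vector [vector [A + 2 * \<alpha> * y + \<gamma> * y\<^sup>2, K12],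
                vector [K12, B + 2 * \<beta> * x + \<gamma> * x\<^sup>2]])"

lemma linear_killing_tensor: "linear (\<lambda>K. killing_tensor K z)"
  by (rule linearI) (auto simp: Let_def vec_eq_iff forall_2 algebra_simps)

lemma inj_killing_tensor: "inj killing_tensor"
proof (rule injI)
  fix K L :: killing
  assume eq: "killing_tensor K = killing_tensor L"
  obtain A B C a b c where K: "K = (A, B, C, a, b, c)" by (cases K)
  obtain A' B' C' a' b' c' where L: "L = (A', B', C', a', b', c')" by (cases L)
  have *: "killing_tensor K (vector [x, y]) $ i $ j = killing_tensor L (vector [x, y]) $ i $ j"
    for x y i j using eq by simp
  show "K = L"
    using *[of 0 0 1 1] *[of 0 1 1 1] *[of 0 "-1" 1 1] *[of 0 0 2 2] *[of 1 0 2 2]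
      *[of "-1" 0 2 2] *[of 0 0 1 2]
    by (auto simp: K L Let_def)
qed

subsection \<open>The vector fields and the distribution they span\<close>

fun V1 :: "killing \<Rightarrow> killing" where
  "V1 (A, B, C, \<alpha>, \<beta>, \<gamma>) = (0, - 2 * \<beta>, \<alpha>, 0, - \<gamma>, 0)"

fun V2 :: "killing \<Rightarrow> killing" where
  "V2 (A, B, C, \<alpha>, \<beta>, \<gamma>) = (- 2 * \<alpha>, 0, \<beta>, - \<gamma>, 0, 0)"

fun V3 :: "killing \<Rightarrow> killing" where
  "V3 (A, B, C, \<alpha>, \<beta>, \<gamma>) = (- 2 * C, 2 * C, A - B, \<beta>, - \<alpha>, 0)"

fun V4 :: "killing \<Rightarrow> killing" where
  "V4 (A, B, C, \<alpha>, \<beta>, \<gamma>) = (2 * A, 2 * B, 2 * C, \<alpha>, \<beta>, 0)"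

fun V5 :: "killing \<Rightarrow> killing" where
  "V5 (A, B, C, \<alpha>, \<beta>, \<gamma>) = (1, 1, 0, 0, 0, 0)"

fun V6 :: "killing \<Rightarrow> killing" where
  "V6 (A, B, C, \<alpha>, \<beta>, \<gamma>) = (A, B, C, \<alpha>, \<beta>, \<gamma>)"

definition web_fields :: "(killing \<Rightarrow> killing) set" where
  "web_fields = {V1, V2, V3, V4, V5, V6}"

definition Delta_E :: "killing \<Rightarrow> killing set" where
  "Delta_E K = span {V K | V. V \<in> web_fields}"

definition rank_Delta_E :: "killing \<Rightarrow> nat" where
  "rank_Delta_E K = dim (Delta_E K)"

subsection \<open>The group generated by the flows and the change of sign\<close>

text \<open>All six fields are affine, hence complete, so only global flows are needed.\<close>

definition is_flow :: "('a::real_normed_vector \<Rightarrow> 'a) \<Rightarrow> (real \<Rightarrow> 'a \<Rightarrow> 'a) \<Rightarrow> bool" where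
  "is_flow V \<phi> \<longleftrightarrow>
    \<phi> 0 = id \<and> (\<forall>s t. \<phi> (s + t) = \<phi> s \<circ> \<phi> t) \<and>
    (\<forall>t p. ((\<lambda>s. \<phi> s p) has_vector_derivative V (\<phi> t p)) (at t))"

definition flow_maps :: "(killing \<Rightarrow> killing) set" where
  "flow_maps = {\<phi> t | \<phi> t V. V \<in> web_fields \<and> is_flow V \<phi>}"

definition G_E :: "(killing \<Rightarrow> killing) monoid" where
  "G_E = (BijGroup UNIV)\<lparr>carrier := generate (BijGroup UNIV) (insert uminus flow_maps)\<rparr>"

lemma flow_maps_Bij: "flow_maps \<subseteq> Bij UNIV"
proof
  fix f assume "f \<in> flow_maps"
  then obtain \<phi> t V where f: "f = \<phi> t" and "is_flow V \<phi>"
    by (auto simp: flow_maps_def)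
  then have "\<phi> (- t + t) = \<phi> (- t) \<circ> \<phi> t" "\<phi> (t + - t) = \<phi> t \<circ> \<phi> (- t)" "\<phi> 0 = id"
    unfolding is_flow_def by blast+
  then have "\<phi> (- t) \<circ> \<phi> t = id" "\<phi> t \<circ> \<phi> (- t) = id" by simp_all
  then show "f \<in> Bij UNIV"
    unfolding f Bij_def by (auto intro: o_bij)
qed

lemma group_action_G_E: "group_action G_E UNIV (\<lambda>g. g)"
proof -
  interpret B: group "BijGroup (UNIV :: killing set)" by (rule group_BijGroup)
  have "(uminus :: killing \<Rightarrow> killing) \<in> Bij UNIV"
    by (auto simp: Bij_def intro!: o_bij[of uminus])
  then have "insert uminus flow_maps \<subseteq> carrier (BijGroup UNIV)"
    using flow_maps_Bij by (simp add: BijGroup_def)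
  from B.generate_is_subgroup[OF this]
  have sub: "subgroup (carrier G_E) (BijGroup UNIV)" by (simp add: G_E_def)
  have "group G_E"
    using B.subgroup_imp_group[OF sub] by (simp add: G_E_def)
  moreover have "(\<lambda>g. g) \<in> hom G_E (BijGroup UNIV)"
    using subgroup.subset[OF sub] by (auto simp: hom_def G_E_def)
  ultimately show ?thesis
    by (simp add: group_action_def group_hom_def group_hom_axioms_def group_BijGroup)
qed

subsection \<open>The subsets\<close>

definition S1 :: "killing set" where
  "S1 = {(A, B, C, \<alpha>, \<beta>, \<gamma>). \<gamma> = 0}"

definition S2 :: "killing set" where
  "S2 = {(A, B, C, \<alpha>, \<beta>, \<gamma>). \<alpha>\<^sup>2 - \<beta>\<^sup>2 = \<gamma> * (A - B) \<and> \<alpha> * \<beta> = - \<gamma> * C}"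

definition S3 :: "killing set" where
  "S3 = {(A, B, C, \<alpha>, \<beta>, \<gamma>). \<alpha> = 0 \<and> \<beta> = 0 \<and> \<gamma> = 0 \<and> C = 0 \<and> A = B}"

end

theory Submission
  imports Defs
begin

text \<open>
  On \<open>S1 \<inter> S2\<close> the equations degenerate to \<open>\<alpha>\<^sup>2 = \<beta>\<^sup>2\<close> and \<open>\<alpha> \<beta> = 0\<close>, so this set consists of the
  constant tensors \<open>(A, B, C, 0, 0, 0)\<close>, that is, of constant symmetric matrices, and \<open>S3\<close> of the
  multiples of the metric. Modulo the metric, all that is left is the trace-free part \<open>((A - B) / 2, C)\<close> of the
  matrix, a vector of a plane which vanishes exactly on \<open>S3\<close>.

  There the translations vanish and the dilatation is twice the scaling, which leaves three
  directions: adding the metric changes the trace, while rotation and scaling move the nonzero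
  trace-free part in two orthogonal directions. Hence the rank is 3, and the explicit flows of these
  three fields reach every point of the set from \<open>(1, -1, 0, 0, 0, 0)\<close>, by polar coordinates for the
  trace-free part.

  It remains to see that no element of the group leaves the set. A flow is any one-parameter group of
  maps whose orbits solve the differential equation, so this is shown for integral curves: along
  every field the derivatives of \<open>\<alpha>\<^sup>2 + \<beta>\<^sup>2 + \<gamma>\<^sup>2\<close> and, once this is zero, of \<open>(A - B)\<^sup>2 + 4 C\<^sup>2\<close>
  are bounded by a multiple of the quantity itself. By Gronwall's inequality, lemma
  \<open>nonneg_zero_propagates\<close>, each of the two is either zero or nonzero along a whole curve.
\<close>

section \<open>The constant tensors that are not multiples of the metric\<close>

fun nonconst_sq :: "killing \<Rightarrow> real" where
  "nonconst_sq (A, B, C, \<alpha>, \<beta>, \<gamma>) = \<alpha>\<^sup>2 + \<beta>\<^sup>2 + \<gamma>\<^sup>2"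

text \<open>
  Four times the squared length of the trace-free part \<open>((A - B) / 2, C)\<close> of the constant term.
\<close>

fun tracefree_sq :: "killing \<Rightarrow> real" where
  "tracefree_sq (A, B, C, \<alpha>, \<beta>, \<gamma>) = (A - B)\<^sup>2 + 4 * C\<^sup>2"

lemma nonconst_sq_nonneg: "0 \<le> nonconst_sq K"
  by (cases K rule: nonconst_sq.cases) simp

lemma tracefree_sq_nonneg: "0 \<le> tracefree_sq K"
  by (cases K rule: tracefree_sq.cases) simp

lemma nonconst_sq_eq_0_iff: "nonconst_sq (A, B, C, \<alpha>, \<beta>, \<gamma>) = 0 \<longleftrightarrow> \<alpha> = 0 \<and> \<beta> = 0 \<and> \<gamma> = 0"
  by (simp add: add_nonneg_eq_0_iff)

lemma tracefree_sq_eq_0_iff: "tracefree_sq (A, B, C, \<alpha>, \<beta>, \<gamma>) = 0 \<longleftrightarrow> A = B \<and> C = 0"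
  by (simp add: add_nonneg_eq_0_iff)

lemma mem_S1_S2_minus_S3_iff:
  "K \<in> (S1 \<inter> S2) - S3 \<longleftrightarrow> nonconst_sq K = 0 \<and> tracefree_sq K \<noteq> 0"
  by (cases K rule: nonconst_sq.cases)
    (auto simp: S1_def S2_def S3_def nonconst_sq_eq_0_iff tracefree_sq_eq_0_iff
      simp del: nonconst_sq.simps tracefree_sq.simps)

lemma S1_S2_minus_S3_cases:
  assumes "K \<in> (S1 \<inter> S2) - S3"
  obtains A B C where "K = (A, B, C, 0, 0, 0)" "(A - B)\<^sup>2 + 4 * C\<^sup>2 \<noteq> 0"
  using assms unfolding mem_S1_S2_minus_S3_iff
  by (cases K rule: nonconst_sq.cases) (auto simp: add_nonneg_eq_0_iff)

section \<open>The rank\<close>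

text \<open>
  The determinant of \<open>V3\<close>, \<open>V5\<close> and \<open>V6\<close> in the coordinates \<open>(A, B, C)\<close> is
  \<open>- ((A - B)\<^sup>2 + 4 C\<^sup>2)\<close>, hence nonzero, while the other three fields add nothing to their span.
\<close>

lemma rank_Delta_E_eq_3:
  assumes "K \<in> (S1 \<inter> S2) - S3"
  shows "rank_Delta_E K = 3"
proof -
  obtain A B C where K: "K = (A, B, C, 0, 0, 0)" and ne: "(A - B)\<^sup>2 + 4 * C\<^sup>2 \<noteq> 0"
    using assms by (rule S1_S2_minus_S3_cases)
  define f :: "real \<times> real \<times> real \<Rightarrow> killing"
    where "f = (\<lambda>(x, y, z). x *\<^sub>R V3 K + y *\<^sub>R V5 K + z *\<^sub>R V6 K)"
  have V12: "V1 K = 0" "V2 K = 0" and V4: "V4 K = 2 *\<^sub>R V6 K"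
    by (simp_all add: K zero_prod_def)
  have gen: "{V K | V. V \<in> web_fields} = {V1 K, V2 K, V3 K, V4 K, V5 K, V6 K}"
    by (auto simp: web_fields_def)
  have "Delta_E K = span {V3 K, V5 K, V6 K}"
    unfolding Delta_E_def gen V12 V4
  proof (rule span_eq[THEN iffD2], intro conjI)
    show "{0, 0, V3 K, 2 *\<^sub>R V6 K, V5 K, V6 K} \<subseteq> span {V3 K, V5 K, V6 K}"
      by (auto intro: span_zero span_base span_scale)
    show "{V3 K, V5 K, V6 K} \<subseteq> span {0, 0, V3 K, 2 *\<^sub>R V6 K, V5 K, V6 K}"
      by (auto intro: span_base)
  qed
  also have "\<dots> = range f"
  proof (rule Set.set_eqI)
    fix v
    have "v \<in> span {V3 K, V5 K, V6 K} \<longleftrightarrow>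
        (\<exists>x y z. v - x *\<^sub>R V3 K - y *\<^sub>R V5 K - z *\<^sub>R V6 K = 0)"
      by (simp only: span_breakdown_eq span_empty singleton_iff)
    also have "\<dots> \<longleftrightarrow> (\<exists>x y z. v = f (x, y, z))"
      by (simp add: f_def algebra_simps)
    finally show "v \<in> span {V3 K, V5 K, V6 K} \<longleftrightarrow> v \<in> range f"
      by (auto simp: image_iff)
  qed
  finally have "Delta_E K = range f" .
  moreover have "linear f"
    by (rule linearI) (auto simp: f_def algebra_simps)
  moreover have "inj f"
    unfolding linear_injective_0[OF \<open>linear f\<close>]
  proof (intro allI impI)
    fix v assume "f v = 0"
    obtain x y z where v: "v = (x, y, z)" by (cases v)
    have eqs: "- 2 * C * x + y + z * A = 0" "2 * C * x + y + z * B = 0" "(A - B) * x + z * C = 0"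
      using \<open>f v = 0\<close> by (simp_all add: f_def v K zero_prod_def algebra_simps)
    have "((A - B)\<^sup>2 + 4 * C\<^sup>2) * x = 0"
      using eqs by algebra
    then have x: "x = 0" using ne by simp
    have "z * (A - B) = 0" "z * C = 0"
      using eqs unfolding x by algebra+
    then have z: "z = 0" using ne by auto
    show "v = 0" using eqs by (simp add: v x z zero_prod_def)
  qed
  ultimately show ?thesis
    unfolding rank_Delta_E_def by (simp add: dim_image_eq)
qed

section \<open>Invariance under the group\<close>

lemma nonneg_zero_forward:
  fixes q q' :: "real \<Rightarrow> real"
  assumes der: "\<And>t. (q has_real_derivative q' t) (at t)"
    and nonneg: "\<And>t. 0 \<le> q t"
    and bound: "\<And>t. q' t \<le> k * q t"
    and "q s = 0" "s \<le> t"
  shows "q t = 0"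
proof -
  have "q t * exp (- k * t) \<le> q s * exp (- k * s)"
  proof (rule DERIV_nonpos_imp_nonincreasing[OF \<open>s \<le> t\<close>])
    fix x
    have "((\<lambda>t. q t * exp (- k * t)) has_real_derivative (q' x - k * q x) * exp (- k * x)) (at x)"
      by (auto intro!: derivative_eq_intros der simp: algebra_simps)
    moreover have "(q' x - k * q x) * exp (- k * x) \<le> 0"
      using bound[of x] by (simp add: mult_le_0_iff)
    ultimately show "\<exists>y. ((\<lambda>t. q t * exp (- k * t)) has_real_derivative y) (at x) \<and> y \<le> 0"
      by blast
  qed
  then have "q t * exp (- k * t) \<le> 0" using \<open>q s = 0\<close> by simp
  then have "q t \<le> 0" by (simp add: mult_le_0_iff)
  with nonneg[of t] show ?thesis by simp
qed

text \<open>
  Gronwall's inequality in both directions of time: a nonnegative quantity whose logarithmic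
  derivative is bounded cannot reach zero, nor leave it.
\<close>

lemma nonneg_zero_propagates:
  fixes q q' :: "real \<Rightarrow> real"
  assumes der: "\<And>t. (q has_real_derivative q' t) (at t)"
    and nonneg: "\<And>t. 0 \<le> q t"
    and bound: "\<And>t. \<bar>q' t\<bar> \<le> k * q t"
    and "q s = 0"
  shows "q t = 0"
proof (cases "s \<le> t")
  case True
  have "q' t \<le> k * q t" for t using bound[of t] by simp
  from nonneg_zero_forward[OF der nonneg this \<open>q s = 0\<close> True] show ?thesis .
next
  case False
  have "((\<lambda>t. q (- t)) has_real_derivative - q' (- t)) (at t)" for t
    using DERIV_mirror[of q "q' (- t)" t] der[of "- t"] by simp
  moreover have "- q' (- t) \<le> k * q (- t)" for t using bound[of "- t"] by simp
  ultimately have "q (- (- t)) = 0"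
    using nonneg_zero_forward[of "\<lambda>t. q (- t)" "\<lambda>t. - q' (- t)" k "- s" "- t"] nonneg
      False \<open>q s = 0\<close> by simp
  then show ?thesis by simp
qed

lemma has_real_derivative_coords:
  fixes c :: "real \<Rightarrow> killing"
  assumes "(c has_vector_derivative (A', B', C', \<alpha>', \<beta>', \<gamma>')) (at t)"
  shows "((\<lambda>s. fst (c s)) has_real_derivative A') (at t)"
    "((\<lambda>s. fst (snd (c s))) has_real_derivative B') (at t)"
    "((\<lambda>s. fst (snd (snd (c s)))) has_real_derivative C') (at t)"
    "((\<lambda>s. fst (snd (snd (snd (c s))))) has_real_derivative \<alpha>') (at t)"
    "((\<lambda>s. fst (snd (snd (snd (snd (c s)))))) has_real_derivative \<beta>') (at t)"
    "((\<lambda>s. snd (snd (snd (snd (snd (c s)))))) has_real_derivative \<gamma>') (at t)"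
proof -
  note F = bounded_linear.has_vector_derivative[OF bounded_linear_fst]
  note S = bounded_linear.has_vector_derivative[OF bounded_linear_snd]
  note s1 = S[OF assms]
  note s2 = S[OF s1[simplified]]
  note s3 = S[OF s2[simplified]]
  note s4 = S[OF s3[simplified]]
  show "((\<lambda>s. fst (c s)) has_real_derivative A') (at t)"
    "((\<lambda>s. fst (snd (c s))) has_real_derivative B') (at t)"
    "((\<lambda>s. fst (snd (snd (c s)))) has_real_derivative C') (at t)"
    "((\<lambda>s. fst (snd (snd (snd (c s))))) has_real_derivative \<alpha>') (at t)"
    "((\<lambda>s. fst (snd (snd (snd (snd (c s)))))) has_real_derivative \<beta>') (at t)"
    "((\<lambda>s. snd (snd (snd (snd (snd (c s)))))) has_real_derivative \<gamma>') (at t)"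
    using F[OF assms] F[OF s1] F[OF s2] F[OF s3] F[OF s4] S[OF s4]
    by (simp_all add: has_real_derivative_iff_has_vector_derivative)
qed

lemma nonconst_sq_along_curve:
  assumes der: "(c has_vector_derivative V (c t)) (at t)" and V: "V \<in> web_fields"
  shows "\<exists>d. ((\<lambda>s. nonconst_sq (c s)) has_real_derivative d) (at t) \<and> \<bar>d\<bar> \<le> 2 * nonconst_sq (c t)"
proof -
  obtain A B C a b g where c: "c t = (A, B, C, a, b, g)" by (cases "c t")
  obtain A' B' C' a' b' g' where v: "V (c t) = (A', B', C', a', b', g')" by (cases "V (c t)")
  have eq: "nonconst_sq K = (fst (snd (snd (snd K))))\<^sup>2 + (fst (snd (snd (snd (snd K)))))\<^sup>2
      + (snd (snd (snd (snd (snd K)))))\<^sup>2" for K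
    by (cases K rule: nonconst_sq.cases) simp
  note D = has_real_derivative_coords[OF der[unfolded v]]
  have "((\<lambda>s. nonconst_sq (c s)) has_real_derivative 2 * a * a' + 2 * b * b' + 2 * g * g') (at t)"
    unfolding eq by (rule derivative_eq_intros D refl)+ (simp add: c)
  moreover have "\<bar>2 * a * a' + 2 * b * b' + 2 * g * g'\<bar> \<le> 2 * nonconst_sq (c t)"
  proof -
    \<comment> \<open>The translation fields give the mixed terms \<open>- 2 \<beta> \<gamma>\<close> and \<open>- 2 \<alpha> \<gamma>\<close>.\<close>
    have "2 * \<bar>b * g\<bar> \<le> 2 * (a\<^sup>2 + b\<^sup>2 + g\<^sup>2)" "2 * \<bar>a * g\<bar> \<le> 2 * (a\<^sup>2 + b\<^sup>2 + g\<^sup>2)"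
      using sum_squares_bound[of "\<bar>b\<bar>" "\<bar>g\<bar>"] sum_squares_bound[of "\<bar>a\<bar>" "\<bar>g\<bar>"]
        zero_le_power2[of a] zero_le_power2[of b] zero_le_power2[of g]
      by (auto simp only: abs_mult power2_abs mult.assoc distrib_left)
    moreover consider "V = V1" | "V = V2" | "V = V3" | "V = V4" | "V = V5" | "V = V6"
      using V by (auto simp: web_fields_def)
    then have "2 * a * a' + 2 * b * b' + 2 * g * g'
        \<in> {- 2 * (b * g), - 2 * (a * g), 0, 2 * (a\<^sup>2 + b\<^sup>2), 2 * (a\<^sup>2 + b\<^sup>2 + g\<^sup>2)}"
      using v by cases (auto simp: c power2_eq_square)
    ultimately show ?thesis by (auto simp: c abs_mult)
  qed
  ultimately show ?thesis by blast
qed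

text \<open>
  The translations shift the trace-free part by multiples of the nonconstant part, so its length is
  controlled only along curves of constant tensors.
\<close>

lemma tracefree_sq_along_curve:
  assumes der: "(c has_vector_derivative V (c t)) (at t)" and V: "V \<in> web_fields"
    and const: "nonconst_sq (c t) = 0"
  shows "\<exists>d. ((\<lambda>s. tracefree_sq (c s)) has_real_derivative d) (at t) \<and> \<bar>d\<bar> \<le> 4 * tracefree_sq (c t)"
proof -
  obtain A B C where c: "c t = (A, B, C, 0, 0, 0)"
    using const nonconst_sq_eq_0_iff by (metis prod_cases6)
  obtain A' B' C' a' b' g' where v: "V (c t) = (A', B', C', a', b', g')" by (cases "V (c t)")
  have eq: "tracefree_sq K = (fst K - fst (snd K))\<^sup>2 + 4 * (fst (snd (snd K)))\<^sup>2" for K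
    by (cases K rule: tracefree_sq.cases) simp
  note D = has_real_derivative_coords[OF der[unfolded v]]
  have "((\<lambda>s. tracefree_sq (c s)) has_real_derivative 2 * (A - B) * (A' - B') + 8 * C * C') (at t)"
    unfolding eq by (rule derivative_eq_intros D refl)+ (simp add: c)
  moreover have "\<bar>2 * (A - B) * (A' - B') + 8 * C * C'\<bar> \<le> 4 * tracefree_sq (c t)"
  proof -
    consider "V = V1" | "V = V2" | "V = V3" | "V = V4" | "V = V5" | "V = V6"
      using V by (auto simp: web_fields_def)
    then have "2 * (A - B) * (A' - B') + 8 * C * C'
        \<in> {0, 4 * ((A - B)\<^sup>2 + 4 * C\<^sup>2), 2 * ((A - B)\<^sup>2 + 4 * C\<^sup>2)}"
      using v by cases (auto simp: c power2_eq_square algebra_simps)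
    then show ?thesis by (auto simp: c)
  qed
  ultimately show ?thesis by blast
qed

lemma web_curve_invariant:
  assumes V: "V \<in> web_fields" and der: "\<And>t. (c has_vector_derivative V (c t)) (at t)"
    and s: "c s \<in> (S1 \<inter> S2) - S3"
  shows "c t \<in> (S1 \<inter> S2) - S3"
proof -
  have "\<forall>t. \<exists>d. ((\<lambda>s. nonconst_sq (c s)) has_real_derivative d) (at t) \<and> \<bar>d\<bar> \<le> 2 * nonconst_sq (c t)"
    using nonconst_sq_along_curve[where c = c, OF der V] by blast
  then obtain q where q: "\<And>t. ((\<lambda>s. nonconst_sq (c s)) has_real_derivative q t) (at t)"
      "\<And>t. \<bar>q t\<bar> \<le> 2 * nonconst_sq (c t)" by metis
  have const: "nonconst_sq (c t) = 0" for t
    using nonneg_zero_propagates[OF q(1) nonconst_sq_nonneg q(2), of s t] s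
    by (simp only: mem_S1_S2_minus_S3_iff)
  have "\<forall>t. \<exists>d. ((\<lambda>s. tracefree_sq (c s)) has_real_derivative d) (at t) \<and> \<bar>d\<bar> \<le> 4 * tracefree_sq (c t)"
    using tracefree_sq_along_curve[where c = c, OF der V const] by blast
  then obtain r where r: "\<And>t. ((\<lambda>s. tracefree_sq (c s)) has_real_derivative r t) (at t)"
      "\<And>t. \<bar>r t\<bar> \<le> 4 * tracefree_sq (c t)" by metis
  have "tracefree_sq (c t) \<noteq> 0"
    using nonneg_zero_propagates[OF r(1) tracefree_sq_nonneg r(2), of t s] s
    unfolding mem_S1_S2_minus_S3_iff by blast
  with const show ?thesis unfolding mem_S1_S2_minus_S3_iff by blast
qed

text \<open>
  An integral curve can be followed in both directions of time, which gives an equivalence; in this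
  form invariance passes to the inverses of the generators.
\<close>

lemma generator_invariant_iff:
  assumes "h \<in> insert uminus flow_maps"
  shows "h K \<in> (S1 \<inter> S2) - S3 \<longleftrightarrow> K \<in> (S1 \<inter> S2) - S3"
proof (cases "h = uminus")
  case True
  have "nonconst_sq (- K) = nonconst_sq K" "tracefree_sq (- K) = tracefree_sq K"
    by (cases K rule: nonconst_sq.cases; simp add: power2_commute)+
  then show ?thesis by (simp only: True mem_S1_S2_minus_S3_iff)
next
  case False
  then obtain \<phi> t V where h: "h = \<phi> t" and V: "V \<in> web_fields" and flow: "is_flow V \<phi>"
    using assms by (auto simp: flow_maps_def)
  have start: "\<phi> 0 K = K"
    and der: "\<And>t. ((\<lambda>s. \<phi> s K) has_vector_derivative V (\<phi> t K)) (at t)"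
    using flow unfolding is_flow_def by (metis id_apply, blast)
  show ?thesis
    using web_curve_invariant[OF V der, of 0 t] web_curve_invariant[OF V der, of t 0]
    unfolding h start by blast
qed

lemma G_E_invariant_iff:
  assumes "g \<in> carrier G_E"
  shows "g K \<in> (S1 \<inter> S2) - S3 \<longleftrightarrow> K \<in> (S1 \<inter> S2) - S3"
proof -
  have gens: "insert uminus flow_maps \<subseteq> Bij (UNIV :: killing set)"
    using flow_maps_Bij by (auto simp: Bij_def intro!: o_bij[of uminus])
  interpret B: group "BijGroup (UNIV :: killing set)" by (rule group_BijGroup)
  have gens': "insert uminus flow_maps \<subseteq> carrier (BijGroup (UNIV :: killing set))"
    using gens by (simp add: BijGroup_def)
  have "g \<in> generate (BijGroup UNIV) (insert uminus flow_maps)"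
    using assms by (simp add: G_E_def)
  then show ?thesis
  proof (induction arbitrary: K rule: generate.induct)
    case one
    show ?case by (simp add: BijGroup_def)
  next
    case (incl h)
    then show ?case by (rule generator_invariant_iff)
  next
    case (inv h)
    have "h \<in> Bij UNIV" using inv gens by blast
    then have "h ((inv\<^bsub>BijGroup UNIV\<^esub> h) K) = K"
      by (simp add: inv_BijGroup Bij_def bij_betw_def surj_f_inv_f)
    then show ?case using generator_invariant_iff[OF inv] by metis
  next
    case (eng h1 h2)
    have "h1 \<in> Bij UNIV" "h2 \<in> Bij UNIV"
      using B.generate_in_carrier[OF gens' eng.hyps(1)] B.generate_in_carrier[OF gens' eng.hyps(2)]
      by (simp_all add: BijGroup_def)
    then show ?case using eng.IH by (simp add: BijGroup_def compose_def)
  qed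
qed

section \<open>Transitivity\<close>

lemma flow_map_in_G_E:
  assumes "is_flow V \<phi>" "V \<in> web_fields"
  shows "\<phi> t \<in> carrier G_E"
  unfolding G_E_def using assms by (auto simp: flow_maps_def intro!: generate.incl)

lemma comp_in_G_E:
  assumes "f \<in> carrier G_E" "g \<in> carrier G_E"
  shows "f \<circ> g \<in> carrier G_E"
proof -
  interpret A: group_action G_E UNIV "\<lambda>g. g" by (rule group_action_G_E)
  have "f \<in> Bij UNIV" "g \<in> Bij UNIV"
    using A.bij_prop0 assms by (auto simp: Bij_def)
  then have "f \<otimes>\<^bsub>G_E\<^esub> g = f \<circ> g"
    by (simp add: G_E_def BijGroup_def compose_def fun_eq_iff)
  then show ?thesis
    using A.group_hom assms by (metis group.is_monoid group_hom.axioms(1) monoid.m_closed)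
qed

text \<open>
  The trace-free part turns twice as fast as the vector \<open>(\<alpha>, \<beta>)\<close>, and in the opposite sense.
\<close>

fun rotation :: "real \<Rightarrow> killing \<Rightarrow> killing" where
  "rotation t (A, B, C, \<alpha>, \<beta>, \<gamma>) =
    ((A + B) / 2 + (cos (2 * t) * ((A - B) / 2) - sin (2 * t) * C),
     (A + B) / 2 - (cos (2 * t) * ((A - B) / 2) - sin (2 * t) * C),
     sin (2 * t) * ((A - B) / 2) + cos (2 * t) * C,
     cos t * \<alpha> + sin t * \<beta>, - sin t * \<alpha> + cos t * \<beta>, \<gamma>)"

lemma is_flow_rotation: "is_flow V3 rotation"
  unfolding is_flow_def
proof (intro conjI allI)
  show "rotation 0 = id" by (auto simp: fun_eq_iff field_simps)
  show "rotation (s + t) = rotation s \<circ> rotation t" for s t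
    by (auto simp: fun_eq_iff distrib_left sin_add cos_add field_simps)
  show "((\<lambda>s. rotation s K) has_vector_derivative V3 (rotation t K)) (at t)" for t K
    by (cases K rule: nonconst_sq.cases)
      (auto intro!: has_vector_derivative_Pair derivative_eq_intros
        simp: has_real_derivative_iff_has_vector_derivative[symmetric] field_simps)
qed

lemma is_flow_add_metric: "is_flow V5 (\<lambda>t K. K + t *\<^sub>R (1, 1, 0, 0, 0, 0))"
proof -
  have "V5 K = (1, 1, 0, 0, 0, 0)" for K by (cases K rule: V5.cases) simp
  then show ?thesis
    unfolding is_flow_def
    by (auto simp: fun_eq_iff scaleR_add_left algebra_simps simp del: scaleR_Pair
        intro!: derivative_eq_intros)
qed

lemma is_flow_scaling: "is_flow V6 (\<lambda>t K. exp t *\<^sub>R K)"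
proof -
  have "V6 K = K" for K by (cases K rule: V6.cases) simp
  then show ?thesis
    unfolding is_flow_def
    by (auto simp: fun_eq_iff exp_add has_real_derivative_iff_has_vector_derivative[symmetric]
        intro!: derivative_eq_intros)
qed

text \<open>
  Polar coordinates for the trace-free part: scale to the right length, turn it, then correct the
  trace. The flow of \<open>V3\<close> at time \<open>t\<close> turns the trace-free part by \<open>2 t\<close>, hence the half angle.
\<close>

lemma G_E_transitive:
  assumes "K \<in> (S1 \<inter> S2) - S3"
  shows "\<exists>g \<in> carrier G_E. K = g (1, -1, 0, 0, 0, 0)"
proof -
  obtain A B C where K: "K = (A, B, C, 0, 0, 0)" and ne: "(A - B)\<^sup>2 + 4 * C\<^sup>2 \<noteq> 0"
    using assms by (rule S1_S2_minus_S3_cases)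
  define z where "z = Complex ((A - B) / 2) C"
  have "z \<noteq> 0" using ne by (auto simp: z_def Complex_eq_0)
  define r where "r = cmod z"
  have r: "exp (ln r) = r" using \<open>z \<noteq> 0\<close> by (simp add: r_def)
  obtain \<theta> where "z = rcis r \<theta>" using rcis_cmod_Arg[of z] unfolding r_def by metis
  then have \<theta>: "(A - B) / 2 = r * cos \<theta>" "C = r * sin \<theta>"
    by (metis Re_rcis complex.sel(1) z_def, metis Im_rcis complex.sel(2) z_def)
  have AB: "A = (A + B) / 2 + (A - B) / 2" "B = (A + B) / 2 - (A - B) / 2"
    by (simp_all add: field_simps)
  let ?g = "(\<lambda>K. K + ((A + B) / 2) *\<^sub>R (1, 1, 0, 0, 0, 0)) \<circ> (rotation (\<theta> / 2) \<circ> (\<lambda>K. exp (ln r) *\<^sub>R K))"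
  have "?g \<in> carrier G_E"
    using flow_map_in_G_E[OF is_flow_rotation] flow_map_in_G_E[OF is_flow_add_metric]
      flow_map_in_G_E[OF is_flow_scaling]
    by (intro comp_in_G_E) (auto simp: web_fields_def)
  moreover have "?g (1, -1, 0, 0, 0, 0) = K"
    unfolding K comp_apply r using \<theta> by (simp add: field_simps)
  ultimately show ?thesis by metis
qed

theorem proposition9:
  shows "(\<forall>K \<in> (S1 \<inter> S2) - S3. rank_Delta_E K = 3) \<and>
         (S1 \<inter> S2) - S3 \<in> orbits G_E (UNIV :: killing set) (\<lambda>g. g)"
proof
  show "\<forall>K \<in> (S1 \<inter> S2) - S3. rank_Delta_E K = 3"
    using rank_Delta_E_eq_3 by blast
next
  define K0 :: killing where "K0 = (1, -1, 0, 0, 0, 0)"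
  have "K0 \<in> (S1 \<inter> S2) - S3"
    unfolding mem_S1_S2_minus_S3_iff by (simp add: K0_def)
  then have "(S1 \<inter> S2) - S3 = orbit G_E (\<lambda>g. g) K0"
    using G_E_transitive[folded K0_def] G_E_invariant_iff[of _ K0]
    unfolding orbit_def by blast
  then show "(S1 \<inter> S2) - S3 \<in> orbits G_E (UNIV :: killing set) (\<lambda>g. g)"
    unfolding orbits_def by blast
qed

end
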